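(* Let $n$ be a positive integer. The arrangements $\mathrm{Shi}(n)$ and $\mathrm{Ish}(n)$ of hyperplanes in $\mathbb{R}^n$ have the same characteristic polynomial, namely $$\chi(\mathrm{Shi}(n),q)=\chi(\mathrm{Ish}(n),q)=q\,(q-n)^{n-1}.$$
   Context: Write $x_1,\dots,x_n$ for the standard coordinates on $\mathbb{R}^n$. The Shi arrangement is $$\mathrm{Shi}(n)=\{\,x_i-x_j=a : 1\le i<j\le n,\ a\in\{0,1\}\,\},$$ and the Ish arrangement is $$\mathrm{Ish}(n)=\{\,x_i-x_j=0: 1\le i<j\le n\,\}\ \cup\ \{\,x_i-x_n=a : 1\le i\le n-1,\ a\in\{1,\dots,n-i\}\,\}.$$ Characteristic polynomial (finite field definition): let $\mathcal{A}$ be a finite arrangement of hyperplanes in $\mathbb{R}^n$, each given by an equation with integer coefficients. For a prime $p$, reducing the equations modulo $p$ gives an arrangement $\mathcal{A}_p$ in $\mathbb{F}_p^n$. The characteristic polynomial $\chi(\mathcal{A},q)$ is the unique polynomial in $q$ such that, for all sufficiently large primes $p$, $$\chi(\mathcal{A},p)=\#\Big(\mathbb{F}_p^n\setminus\bigcup_{H\in\mathcal{A}_p}H\Big).$$ *)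

theory Defs
  imports "HOL-Number_Theory.Number_Theory" "HOL-Computational_Algebra.Polynomial"
    "HOL-Library.FuncSet"
begin

text \<open>
  A pair \<open>(c, b)\<close> stands for the affine equation \<open>c 1 * x 1 + \<dots> + c n * x n = b\<close> with integer
  coefficients; only the values of \<open>c\<close> on \<open>{1..n}\<close> matter. An arrangement is a set of such
  equations, because the finite field definition of the characteristic polynomial reduces the
  given equations modulo \<open>p\<close>.
\<close>

type_synonym equation = "(nat \<Rightarrow> int) \<times> int"

definition diff_eq :: "nat \<Rightarrow> nat \<Rightarrow> int \<Rightarrow> equation"  \<comment> \<open>\<open>x i - x j = a\<close>\<close>
  where "diff_eq i j a = ((\<lambda>k. of_bool (k = i) - of_bool (k = j)), a)"

definition Shi :: "nat \<Rightarrow> equation set"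
  where "Shi n = {diff_eq i j a | i j a. 1 \<le> i \<and> i < j \<and> j \<le> n \<and> a \<in> {0, 1}}"

definition Ish :: "nat \<Rightarrow> equation set"
  where "Ish n =
    {diff_eq i j 0 | i j. 1 \<le> i \<and> i < j \<and> j \<le> n} \<union>
    {diff_eq i n a | i a. 1 \<le> i \<and> i < n \<and> a \<in> {1..int n - int i}}"

text \<open>
  The field with \<open>p\<close> elements is represented by the residues \<open>{0..<p}\<close>, and its \<open>n\<close>-th power by
  the extensional functions from \<open>{1..n}\<close> into them.
\<close>

definition affine_space_mod :: "nat \<Rightarrow> nat \<Rightarrow> (nat \<Rightarrow> int) set"
  where "affine_space_mod n p = {1..n} \<rightarrow>\<^sub>E {0..<int p}"

definition hyperplane_mod :: "nat \<Rightarrow> nat \<Rightarrow> equation \<Rightarrow> (nat \<Rightarrow> int) set"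
  where "hyperplane_mod n p e =
    {x \<in> affine_space_mod n p. [(\<Sum>k = 1..n. fst e k * x k) = snd e] (mod int p)}"

definition is_characteristic_polynomial :: "nat \<Rightarrow> equation set \<Rightarrow> int poly \<Rightarrow> bool"
  where "is_characteristic_polynomial n A P \<longleftrightarrow>
    (\<forall>\<^sub>F p in sequentially. prime p \<longrightarrow>
      poly P (int p) = int (card (affine_space_mod n p - (\<Union>e\<in>A. hyperplane_mod n p e))))"

lemma is_characteristic_polynomial_unique:
  assumes "is_characteristic_polynomial n A P" "is_characteristic_polynomial n A Q"
  shows "P = Q"
proof (rule ccontr)
  assume "P \<noteq> Q"
  then have fin: "finite {x. poly (P - Q) x = 0}"
    by (intro poly_roots_finite) simp
  have "\<forall>\<^sub>F p in sequentially. prime p \<longrightarrow> poly (P - Q) (int p) = 0"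
    using assms unfolding is_characteristic_polynomial_def
    by eventually_elim simp
  then obtain N where N: "\<And>p. p \<ge> N \<Longrightarrow> prime p \<Longrightarrow> poly (P - Q) (int p) = 0"
    unfolding eventually_sequentially by blast
  have "{p. prime p} \<subseteq> {..<N} \<union> int -` {x. poly (P - Q) x = 0}"
    using N not_le by blast
  moreover have "finite (int -` {x. poly (P - Q) x = 0})"
    using fin by (intro finite_vimageI) simp_all
  ultimately have "finite {p::nat. prime p}"
    using finite_subset by blast
  then show False
    using primes_infinite by blast
qed

definition characteristic_polynomial :: "nat \<Rightarrow> equation set \<Rightarrow> int poly"
  where "characteristic_polynomial n A = (THE P. is_characteristic_polynomial n A P)"

lemma characteristic_polynomial_eqI:
  "is_characteristic_polynomial n A P \<Longrightarrow> characteristic_polynomial n A = P"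
  unfolding characteristic_polynomial_def
  by (blast intro: is_characteristic_polynomial_unique)

end

theory Submission
  imports Defs
begin

text \<open>
  For every modulus \<open>p \<ge> max 2 n\<close>, prime or not, each of the two complements has exactly
  \<open>p * (p - n) ^ (n - 1)\<close> points. Both counts fix one coordinate (\<open>p\<close> possibilities) and then
  exhibit \<open>n - 1\<close> independent choices among \<open>p - n\<close> values each.

  For Ish, fix \<open>x n = c\<close>. Then \<open>x i\<close> must avoid the \<open>n - i + 1\<close> values \<open>c, c + 1, \<dots>, c + (n - i)\<close>
  and the coordinates must be distinct. These forbidden intervals shrink as \<open>i\<close> grows, so when
  \<open>x 1, x 2, \<dots>\<close> are chosen in this order, the \<open>i - 1\<close> earlier coordinates lie outside the
  forbidden interval of \<open>x i\<close> and add \<open>i - 1\<close> new forbidden values: always \<open>n\<close> in total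
  (\<open>card_avoiding_injections\<close>).

  For Shi, regard \<open>x\<close> as a placement of labels \<open>1, \<dots>, n\<close> into distinct cells of a circle with \<open>p\<close>
  cells. The conditions say that no label is directly followed by a smaller one. Rotate label \<open>1\<close>
  into cell \<open>0\<close>. Its predecessor cell \<open>p - 1\<close> must be empty, and label \<open>1\<close> puts no condition on
  cell \<open>1\<close>, so what remains is a row of \<open>p - 2\<close> cells holding the other \<open>n - 1\<close> labels. In a row,
  the cell of the largest label can be cut out and restored: the label can be reinserted exactly
  in front of an empty cell or at the end of the row. A label always disappears together with one
  cell, so the number of empty cells, and with it the number of places for insertion, is the same
  at every stage. This gives \<open>(L + 1 - m) ^ m\<close> placements of \<open>m\<close> labels
  into \<open>L\<close> cells (\<open>card_ascending_placements\<close>), which is \<open>(p - n) ^ (n - 1)\<close> here.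
\<close>

section \<open>Complements in coordinates\<close>

definition complement_mod :: "nat \<Rightarrow> nat \<Rightarrow> equation set \<Rightarrow> (nat \<Rightarrow> int) set"
  where "complement_mod n p A = affine_space_mod n p - (\<Union>e\<in>A. hyperplane_mod n p e)"

lemma sum_diff_eq:
  assumes "i \<in> {1..n}" "j \<in> {1..n}"
  shows "(\<Sum>k = 1..n. fst (diff_eq i j a) k * x k) = x i - x j"
proof -
  have "(\<Sum>k = 1..n. fst (diff_eq i j a) k * x k)
      = (\<Sum>k = 1..n. (if k = i then x k else 0) - (if k = j then x k else 0))"
    by (rule sum.cong) (auto simp: diff_eq_def)
  also have "\<dots> = x i - x j"
    using assms by (simp add: sum_subtractf)
  finally show ?thesis .
qed

lemma mem_hyperplane_mod_diff_eq:
  assumes "i \<in> {1..n}" "j \<in> {1..n}"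
  shows "x \<in> hyperplane_mod n p (diff_eq i j a) \<longleftrightarrow>
    x \<in> affine_space_mod n p \<and> [x i = x j + a] (mod int p)"
proof -
  have "[x i - x j = a] (mod int p) \<longleftrightarrow> [x i = x j + a] (mod int p)"
    by (simp add: cong_iff_dvd_diff algebra_simps)
  then show ?thesis
    unfolding hyperplane_mod_def mem_Collect_eq sum_diff_eq[OF assms]
    by (simp add: diff_eq_def)
qed

lemma mem_complement_Shi:
  "x \<in> complement_mod n p (Shi n) \<longleftrightarrow> x \<in> affine_space_mod n p \<and>
    (\<forall>i j. 1 \<le> i \<and> i < j \<and> j \<le> n \<longrightarrow>
      \<not> [x i = x j] (mod int p) \<and> \<not> [x i = x j + 1] (mod int p))"
proof -
  have "x \<in> complement_mod n p (Shi n) \<longleftrightarrow> x \<in> affine_space_mod n p \<and>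
    (\<forall>i j a. 1 \<le> i \<and> i < j \<and> j \<le> n \<and> a \<in> {0, 1} \<longrightarrow>
      x \<notin> hyperplane_mod n p (diff_eq i j a))"
    unfolding complement_mod_def Shi_def by blast
  also have "\<dots> \<longleftrightarrow> x \<in> affine_space_mod n p \<and>
    (\<forall>i j a. 1 \<le> i \<and> i < j \<and> j \<le> n \<and> a \<in> {0, 1} \<longrightarrow> \<not> [x i = x j + a] (mod int p))"
    by (auto simp: mem_hyperplane_mod_diff_eq)
  also have "\<dots> \<longleftrightarrow> x \<in> affine_space_mod n p \<and>
    (\<forall>i j. 1 \<le> i \<and> i < j \<and> j \<le> n \<longrightarrow>
      \<not> [x i = x j + 0] (mod int p) \<and> \<not> [x i = x j + 1] (mod int p))"
    by blast
  finally show ?thesis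
    by simp
qed

lemma mem_complement_Ish:
  "x \<in> complement_mod n p (Ish n) \<longleftrightarrow> x \<in> affine_space_mod n p \<and>
    (\<forall>i j. 1 \<le> i \<and> i < j \<and> j \<le> n \<longrightarrow> \<not> [x i = x j] (mod int p)) \<and>
    (\<forall>i a. 1 \<le> i \<and> i < n \<and> a \<in> {1..int n - int i} \<longrightarrow> \<not> [x i = x n + a] (mod int p))"
proof -
  have "x \<in> complement_mod n p (Ish n) \<longleftrightarrow> x \<in> affine_space_mod n p \<and>
    (\<forall>i j. 1 \<le> i \<and> i < j \<and> j \<le> n \<longrightarrow> x \<notin> hyperplane_mod n p (diff_eq i j 0)) \<and>
    (\<forall>i a. 1 \<le> i \<and> i < n \<and> a \<in> {1..int n - int i} \<longrightarrow>
      x \<notin> hyperplane_mod n p (diff_eq i n a))"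
    unfolding complement_mod_def Ish_def by blast
  also have "\<dots> \<longleftrightarrow> x \<in> affine_space_mod n p \<and>
    (\<forall>i j. 1 \<le> i \<and> i < j \<and> j \<le> n \<longrightarrow> \<not> [x i = x j + 0] (mod int p)) \<and>
    (\<forall>i a. 1 \<le> i \<and> i < n \<and> a \<in> {1..int n - int i} \<longrightarrow> \<not> [x i = x n + a] (mod int p))"
    by (auto simp: mem_hyperplane_mod_diff_eq)
  finally show ?thesis
    by simp
qed

lemma cong_residues_iff:
  fixes x y :: int
  assumes "x \<in> {0..<p}" "y \<in> {0..<p}"
  shows "[x = y] (mod p) \<longleftrightarrow> x = y"
  using assms by (simp add: cong_def)

lemma card_Sigma_const:
  assumes "finite A" "\<And>a. a \<in> A \<Longrightarrow> finite (B a)" "\<And>a. a \<in> A \<Longrightarrow> card (B a) = k"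
  shows "card (Sigma A B) = card A * k"
  using assms by simp

section \<open>The Ish arrangement: choosing the coordinates one after another\<close>

text \<open>
  Fixing \<open>x n\<close> turns the complement of Ish into a set of this kind, with \<open>k = n - 1\<close> and with \<open>B i\<close>
  the values that \<open>x n\<close> forbids for \<open>x i\<close>.
\<close>

definition avoiding_injections :: "nat \<Rightarrow> 'a set \<Rightarrow> (nat \<Rightarrow> 'a set) \<Rightarrow> (nat \<Rightarrow> 'a) set"
  where "avoiding_injections k F B =
    {x \<in> {1..k} \<rightarrow>\<^sub>E F. inj_on x {1..k} \<and> (\<forall>i\<in>{1..k}. x i \<notin> B i)}"

lemma avoiding_injections_Suc:
  "bij_betw (\<lambda>(x, v). x(Suc k := v))
     (SIGMA x : avoiding_injections k F B. F - (B (Suc k) \<union> x ` {1..k}))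
     (avoiding_injections (Suc k) F B)"
  (is "bij_betw ?f ?A ?C")
proof (rule bij_betwI[where g = "\<lambda>x. (restrict x {1..k}, x (Suc k))"])
  have interval: "{1..Suc k} = insert (Suc k) {1..k}" "Suc k \<notin> {1..k}"
    by auto
  show "?f \<in> ?A \<rightarrow> ?C"
  proof
    fix a assume "a \<in> ?A"
    then obtain x v where a: "a = (x, v)" and x_mem: "x \<in> avoiding_injections k F B"
      and v: "v \<in> F" "v \<notin> B (Suc k) \<union> x ` {1..k}"
      by blast
    from x_mem have x: "x \<in> {1..k} \<rightarrow>\<^sub>E F" "inj_on x {1..k}" "\<forall>i\<in>{1..k}. x i \<notin> B i"
      unfolding avoiding_injections_def by blast+
    have "x(Suc k := v) \<in> {1..Suc k} \<rightarrow>\<^sub>E F"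
      unfolding interval(1) using v(1) x(1) by (rule PiE_fun_upd)
    moreover have "inj_on (x(Suc k := v)) {1..Suc k}"
      unfolding interval(1) inj_on_insert using x(2) v(2) interval(2)
      by (simp add: inj_on_fun_updI fun_upd_image)
    moreover have "\<forall>i\<in>{1..Suc k}. (x(Suc k := v)) i \<notin> B i"
      unfolding interval(1) using x(3) v(2) by auto
    ultimately show "?f a \<in> ?C"
      unfolding a avoiding_injections_def by simp
  qed
  show "(\<lambda>x. (restrict x {1..k}, x (Suc k))) \<in> ?C \<rightarrow> ?A"
  proof
    fix x assume "x \<in> ?C"
    then have x: "x \<in> {1..Suc k} \<rightarrow>\<^sub>E F" "inj_on x {1..Suc k}" "\<forall>i\<in>{1..Suc k}. x i \<notin> B i"
      unfolding avoiding_injections_def by blast+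
    have "restrict x {1..k} \<in> {1..k} \<rightarrow>\<^sub>E F" "x (Suc k) \<in> F"
      using x(1) by (auto simp: PiE_def Pi_def)
    moreover have "inj_on (restrict x {1..k}) {1..k}" "x (Suc k) \<notin> x ` {1..k}"
      using x(2) interval(2) unfolding interval(1) inj_on_insert by simp_all
    ultimately show "(restrict x {1..k}, x (Suc k)) \<in> ?A"
      using x(3) by (auto simp: avoiding_injections_def)
  qed
  show "(restrict (?f a) {1..k}, ?f a (Suc k)) = a" if "a \<in> ?A" for a
  proof -
    obtain y v where a: "a = (y, v)" by (cases a)
    have "y \<in> extensional {1..k}" using that a by (auto simp: avoiding_injections_def PiE_def)
    then show ?thesis unfolding a by (auto simp: fun_eq_iff extensional_def)
  qed
  show "?f (restrict x {1..k}, x (Suc k)) = x" if "x \<in> ?C" for x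
  proof -
    have "x \<in> extensional {1..Suc k}" using that by (auto simp: avoiding_injections_def PiE_def)
    then show ?thesis by (auto simp: fun_eq_iff extensional_def)
  qed
qed

text \<open>
  The size condition makes the loss of forbidden values from \<open>B i\<close> to \<open>B (Suc i)\<close> equal to the gain
  of one value already used; nestedness ensures that the used values are not in \<open>B (Suc i)\<close>, hence
  not counted twice. Every step therefore excludes exactly \<open>N\<close> values.
\<close>

lemma card_avoiding_injections:
  assumes "finite F"
    and sub: "\<And>i. B i \<subseteq> F"
    and nested: "\<And>i j. i \<le> j \<Longrightarrow> B j \<subseteq> B i"
    and size: "\<And>i. i \<in> {1..k} \<Longrightarrow> card (B i) + i = Suc N"
  shows "card (avoiding_injections k F B) = (card F - N) ^ k"
  using size
proof (induction k)
  case 0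
  have "avoiding_injections 0 F B = {\<lambda>_. undefined}"
    by (auto simp: avoiding_injections_def)
  then show ?case by simp
next
  case (Suc k)
  let ?X = "avoiding_injections k F B"
  have fin: "finite ?X"
    unfolding avoiding_injections_def using \<open>finite F\<close>
    by (intro finite_Collect_conjI disjI1) (simp add: finite_PiE)
  have choices: "card (F - (B (Suc k) \<union> x ` {1..k})) = card F - N" if "x \<in> ?X" for x
  proof -
    have x: "x ` {1..k} \<subseteq> F" "inj_on x {1..k}" "\<forall>i\<in>{1..k}. x i \<notin> B i"
      using that by (auto simp: avoiding_injections_def PiE_def Pi_def)
    have "B (Suc k) \<inter> x ` {1..k} = {}"
    proof -
      have "x i \<notin> B (Suc k)" if "i \<in> {1..k}" for i
        using that x(3) nested[of i "Suc k"] by auto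
      then show ?thesis by blast
    qed
    then have "card (B (Suc k) \<union> x ` {1..k}) = card (B (Suc k)) + k"
      using x(2) finite_subset[OF sub \<open>finite F\<close>] by (simp add: card_Un_disjoint card_image)
    also have "\<dots> = N"
      using Suc.prems[of "Suc k"] by simp
    finally show ?thesis
      using x(1) sub[of "Suc k"] finite_subset[OF sub \<open>finite F\<close>]
      by (subst card_Diff_subset) auto
  qed
  have "card (avoiding_injections (Suc k) F B)
      = card (SIGMA x : ?X. F - (B (Suc k) \<union> x ` {1..k}))"
    using bij_betw_same_card[OF avoiding_injections_Suc] by metis
  also have "\<dots> = card ?X * (card F - N)"
    using fin choices \<open>finite F\<close> by (intro card_Sigma_const) auto
  finally show ?case
    using Suc by simp
qed

text \<open>
  The shift \<open>a = 0\<close> is the equation \<open>x i = x n\<close>, so that all conditions between \<open>x i\<close> and \<open>x n\<close> are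
  collected in one interval; those among \<open>x 1, \<dots>, x (n - 1)\<close> only demand injectivity.
\<close>

definition Ish_forbidden :: "nat \<Rightarrow> nat \<Rightarrow> int \<Rightarrow> nat \<Rightarrow> int set"
  where "Ish_forbidden n p c i = (\<lambda>a. (c + a) mod int p) ` {0..int n - int i}"

lemma card_Ish_forbidden:
  assumes "i \<in> {1..n}" "n \<le> p"
  shows "card (Ish_forbidden n p c i) + i = Suc n"
proof -
  have "inj_on (\<lambda>a. (c + a) mod int p) {0..int n - int i}"
  proof (rule inj_onI)
    fix a b
    assume *: "a \<in> {0..int n - int i}" "b \<in> {0..int n - int i}"
      "(c + a) mod int p = (c + b) mod int p"
    then have "[a = b] (mod int p)"
      using cong_add_lcancel[of c a b "int p"] by (simp add: cong_def)
    moreover have "a \<in> {0..<int p}" "b \<in> {0..<int p}"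
      using * assms by auto
    ultimately show "a = b"
      by (simp add: cong_residues_iff)
  qed
  then have "card (Ish_forbidden n p c i) = nat (int n - int i + 1)"
    unfolding Ish_forbidden_def by (simp add: card_image)
  with assms(1) show ?thesis
    by (simp add: nat_diff_distrib nat_add_distrib)
qed

lemma notin_Ish_forbidden:
  assumes "x \<in> {0..<int p}"
  shows "x \<notin> Ish_forbidden n p c i \<longleftrightarrow>
    (\<forall>a\<in>{0..int n - int i}. \<not> [x = c + a] (mod int p))"
  using assms by (auto simp: Ish_forbidden_def cong_def)

lemma complement_Ish_bij:
  assumes "n \<ge> 1"
  shows "bij_betw (\<lambda>(c, z). z(n := c))
     (SIGMA c : {0..<int p}. avoiding_injections (n - 1) {0..<int p} (Ish_forbidden n p c))
     (complement_mod n p (Ish n))"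
  (is "bij_betw ?f ?A ?C")
proof (rule bij_betwI[where g = "\<lambda>x. (x n, restrict x {1..n - 1})"])
  show "?f \<in> ?A \<rightarrow> ?C"
  proof (clarify)
    fix c z
    assume c: "c \<in> {0..<int p}"
      and "z \<in> avoiding_injections (n - 1) {0..<int p} (Ish_forbidden n p c)"
    then have z: "z \<in> {1..n - 1} \<rightarrow>\<^sub>E {0..<int p}" "inj_on z {1..n - 1}"
      "\<And>i. i \<in> {1..n - 1} \<Longrightarrow> z i \<notin> Ish_forbidden n p c i"
      by (auto simp: avoiding_injections_def)
    have avoid: "\<not> [z i = c + a] (mod int p)"
      if "1 \<le> i" "i < n" "a \<in> {0..int n - int i}" for i a
    proof -
      have i: "i \<in> {1..n - 1}" using that by auto
      then have "z i \<in> {0..<int p}" using z(1) by blast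
      then show ?thesis using z(3)[OF i] that by (simp add: notin_Ish_forbidden)
    qed
    have distinct: "\<not> [z i = z j] (mod int p)" if "1 \<le> i" "i < j" "j < n" for i j
    proof -
      have ij: "i \<in> {1..n - 1}" "j \<in> {1..n - 1}" using that by auto
      then have "z i \<in> {0..<int p}" "z j \<in> {0..<int p}" using z(1) by blast+
      moreover have "z i \<noteq> z j" using inj_onD[OF z(2) _ ij] that by auto
      ultimately show ?thesis by (simp add: cong_residues_iff)
    qed
    have "z(n := c) \<in> affine_space_mod n p"
      using z(1) c assms unfolding affine_space_mod_def
      by (auto simp: PiE_def Pi_def extensional_def)
    then show "z(n := c) \<in> complement_mod n p (Ish n)"
      unfolding mem_complement_Ish using avoid[of _ 0] avoid distinct by auto
  qed
  show "(\<lambda>x. (x n, restrict x {1..n - 1})) \<in> ?C \<rightarrow> ?A"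
  proof
    fix x assume "x \<in> ?C"
    then have x: "x \<in> {1..n} \<rightarrow>\<^sub>E {0..<int p}"
      "\<And>i j. 1 \<le> i \<Longrightarrow> i < j \<Longrightarrow> j \<le> n \<Longrightarrow> \<not> [x i = x j] (mod int p)"
      "\<And>i a. 1 \<le> i \<Longrightarrow> i < n \<Longrightarrow> a \<in> {1..int n - int i} \<Longrightarrow> \<not> [x i = x n + a] (mod int p)"
      unfolding mem_complement_Ish affine_space_mod_def by blast+
    have "x i \<notin> Ish_forbidden n p (x n) i" if "i \<in> {1..n - 1}" for i
    proof -
      have i: "1 \<le> i" "i < n" using that by auto
      have "\<not> [x i = x n + a] (mod int p)" if "a \<in> {0..int n - int i}" for a
        using that x(2)[OF i] x(3)[OF i, of a] by (cases "a = 0") auto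
      moreover have "x i \<in> {0..<int p}" using x(1) that by auto
      ultimately show ?thesis by (simp add: notin_Ish_forbidden)
    qed
    moreover have "inj_on x {1..n - 1}"
    proof (rule linorder_inj_onI)
      fix i j assume "i < j" "i \<in> {1..n - 1}" "j \<in> {1..n - 1}"
      then have "1 \<le> i" "i < j" "j \<le> n" by auto
      from x(2)[OF this] show "x i \<noteq> x j" by auto
    qed auto
    moreover have "restrict x {1..n - 1} \<in> {1..n - 1} \<rightarrow>\<^sub>E {0..<int p}" "x n \<in> {0..<int p}"
      using x(1) assms by (auto simp: PiE_def Pi_def)
    ultimately show "(x n, restrict x {1..n - 1}) \<in> ?A"
      by (simp add: avoiding_injections_def inj_on_def)
  qed
  show "(?f y n, restrict (?f y) {1..n - 1}) = y" if "y \<in> ?A" for y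
    using that assms by (auto simp: avoiding_injections_def PiE_def extensional_def fun_eq_iff)
  show "?f (x n, restrict x {1..n - 1}) = x" if "x \<in> ?C" for x
    using that assms
    by (auto simp: mem_complement_Ish affine_space_mod_def PiE_def extensional_def fun_eq_iff)
qed

lemma card_complement_Ish:
  assumes "n \<ge> 1" "p \<ge> n"
  shows "card (complement_mod n p (Ish n)) = p * (p - n) ^ (n - 1)"
proof -
  have *: "card (avoiding_injections (n - 1) {0..<int p} (Ish_forbidden n p c))
      = (card {0..<int p} - n) ^ (n - 1)" for c
  proof (rule card_avoiding_injections)
    show "Ish_forbidden n p c i \<subseteq> {0..<int p}" for i
      using assms by (auto simp: Ish_forbidden_def)
    show "Ish_forbidden n p c j \<subseteq> Ish_forbidden n p c i" if "i \<le> j" for i j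
      using that by (auto simp: Ish_forbidden_def)
    show "card (Ish_forbidden n p c i) + i = Suc n" if "i \<in> {1..n - 1}" for i
      using that assms by (intro card_Ish_forbidden) auto
  qed simp
  have fin: "finite (avoiding_injections (n - 1) {0..<int p} (Ish_forbidden n p c))" for c
    unfolding avoiding_injections_def
    by (intro finite_Collect_conjI disjI1) (simp add: finite_PiE)
  have "card (complement_mod n p (Ish n)) = card {0..<int p} * (p - n) ^ (n - 1)"
    using * fin assms
    by (subst bij_betw_same_card[OF complement_Ish_bij, symmetric]) (auto simp: card_Sigma_const)
  then show ?thesis by simp
qed

section \<open>The Shi arrangement: placing labels in a row of cells\<close>

text \<open>
  A placement of distinct labels in a row of cells \<open>1, \<dots>, L\<close> such that labels in adjacent occupied
  cells increase from left to right: every maximal run of occupied cells is ascending.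
\<close>

definition ascending_placements :: "'a::linorder set \<Rightarrow> nat \<Rightarrow> ('a \<Rightarrow> nat) set"
  where "ascending_placements S L =
    {y \<in> S \<rightarrow>\<^sub>E {1..L}. \<forall>i\<in>S. \<forall>j\<in>S. i < j \<longrightarrow> y i \<noteq> y j \<and> y i \<noteq> Suc (y j)}"

definition open_cell :: "nat \<Rightarrow> nat \<Rightarrow> nat"
  where "open_cell v t = (if t < v then t else Suc t)"

definition close_cell :: "nat \<Rightarrow> nat \<Rightarrow> nat"
  where "close_cell v t = (if t < v then t else t - 1)"

lemma finite_ascending_placements:
  "finite S \<Longrightarrow> finite (ascending_placements S L)"
  unfolding ascending_placements_def
  by (intro finite_Collect_conjI disjI1) (simp add: finite_PiE)

text \<open>
  Opening a new cell at \<open>v\<close> and putting the largest label \<open>b\<close> into it moves the old cell \<open>v\<close> to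
  \<open>Suc v\<close>. As no smaller label may follow \<open>b\<close>, this is allowed exactly if the old cell \<open>v\<close> was empty or
  \<open>v = Suc L\<close> lies beyond the row. The old labels keep their conditions: a pair of adjacent labels
  can only be separated at \<open>v\<close> if the right one is in cell \<open>v\<close>. Conversely, cutting out the cell of \<open>b\<close>
  creates no new adjacent pair, because the cell behind \<open>b\<close> is empty.
\<close>

lemma ascending_placements_insert:
  fixes S :: "'a::linorder set"
  assumes max: "\<And>s. s \<in> S \<Longrightarrow> s < b"
  shows "bij_betw (\<lambda>(y, v). (restrict (open_cell v \<circ> y) S)(b := v))
     (SIGMA y : ascending_placements S L. {1..Suc L} - y ` S)
     (ascending_placements (insert b S) (Suc L))"
  (is "bij_betw ?f ?A ?C")
proof (rule bij_betwI[where g = "\<lambda>x. (restrict (close_cell (x b) \<circ> x) S, x b)"])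
  have b: "b \<notin> S" using max by blast
  show "?f \<in> ?A \<rightarrow> ?C"
  proof (clarify)
    fix y v assume "y \<in> ascending_placements S L" and v: "v \<in> {1..Suc L}" "v \<notin> y ` S"
    then have y: "y \<in> S \<rightarrow>\<^sub>E {1..L}"
      "\<And>i j. i \<in> S \<Longrightarrow> j \<in> S \<Longrightarrow> i < j \<Longrightarrow> y i \<noteq> y j \<and> y i \<noteq> Suc (y j)"
      by (auto simp: ascending_placements_def)
    let ?x = "(restrict (open_cell v \<circ> y) S)(b := v)"
    have old: "?x i \<noteq> ?x j \<and> ?x i \<noteq> Suc (?x j)" if "i \<in> S" "j \<in> S" "i < j" for i j
    proof -
      have "v \<noteq> y i" "v \<noteq> y j" "i \<noteq> b" "j \<noteq> b" using v(2) that b by auto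
      with y(2)[OF that] that show ?thesis by (auto simp: open_cell_def)
    qed
    have new: "?x i \<noteq> ?x b \<and> ?x i \<noteq> Suc (?x b)" if "i \<in> S" for i
    proof -
      have "v \<noteq> y i" "i \<noteq> b" using v(2) that b by auto
      with that show ?thesis by (auto simp: open_cell_def)
    qed
    have "?x i \<noteq> ?x j \<and> ?x i \<noteq> Suc (?x j)"
      if "i \<in> insert b S" "j \<in> insert b S" "i < j" for i j
      using that old new[of i] max by (metis insert_iff order_less_asym)
    moreover have "?x \<in> insert b S \<rightarrow>\<^sub>E {1..Suc L}"
      using y(1) v by (auto simp: PiE_def Pi_def extensional_def open_cell_def)
    ultimately show "?x \<in> ?C"
      unfolding ascending_placements_def by blast
  qed
  have apart: "x s \<noteq> x b \<and> x s \<noteq> Suc (x b)" if "x \<in> ?C" "s \<in> S" for x s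
    using that max by (auto simp: ascending_placements_def)
  have range: "x b \<in> {1..Suc L} \<and> (\<forall>s\<in>S. x s \<in> {1..Suc L})" if "x \<in> ?C" for x
    using that by (auto simp: ascending_placements_def PiE_def Pi_def)
  show "(\<lambda>x. (restrict (close_cell (x b) \<circ> x) S, x b)) \<in> ?C \<rightarrow> ?A"
  proof
    fix x assume x: "x \<in> ?C"
    let ?y = "restrict (close_cell (x b) \<circ> x) S"
    have "?y i \<noteq> ?y j \<and> ?y i \<noteq> Suc (?y j)" if "i \<in> S" "j \<in> S" "i < j" for i j
    proof -
      have "x i \<noteq> x j" "x i \<noteq> Suc (x j)"
        using that x by (auto simp: ascending_placements_def)
      with apart[OF x that(1)] apart[OF x that(2)] range[OF x] that show ?thesis
        by (auto simp: close_cell_def)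
    qed
    moreover have "?y \<in> S \<rightarrow>\<^sub>E {1..L}"
    proof (rule restrict_PiE_iff[THEN iffD2], rule ballI)
      fix s assume "s \<in> S"
      with apart[OF x this] range[OF x] show "(close_cell (x b) \<circ> x) s \<in> {1..L}"
        by (fastforce simp: close_cell_def)
    qed
    moreover have "x b \<noteq> ?y s" if "s \<in> S" for s
      using that apart[OF x that] range[OF x] by (auto simp: close_cell_def)
    ultimately show "(?y, x b) \<in> ?A"
      using range[OF x] unfolding ascending_placements_def by blast
  qed
  show "(restrict (close_cell (?f a b) \<circ> ?f a) S, ?f a b) = a" if "a \<in> ?A" for a
  proof -
    obtain y v where a: "a = (y, v)" by (cases a)
    have "y \<in> extensional S" using that a by (auto simp: ascending_placements_def PiE_def)
    then show ?thesis
      using b unfolding a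
      by (auto simp: fun_eq_iff extensional_def open_cell_def close_cell_def)
  qed
  show "?f (restrict (close_cell (x b) \<circ> x) S, x b) = x" if x: "x \<in> ?C" for x
  proof
    fix s
    have "x \<in> extensional (insert b S)" using x by (auto simp: ascending_placements_def PiE_def)
    then show "?f (restrict (close_cell (x b) \<circ> x) S, x b) s = x s"
      using apart[OF x, of s]
      by (auto simp: extensional_def open_cell_def close_cell_def)
  qed
qed

text \<open>
  Without the largest label and its cell there are \<open>L - 1\<close> cells and \<open>card S - 1\<close> labels, hence again
  \<open>L - card S\<close> empty cells; together with the end of the row they offer \<open>L + 1 - card S\<close> places for the
  largest label. Truncated subtraction is harmless: if there are more labels than cells, both
  sides vanish.
\<close>

lemma card_ascending_placements:
  fixes S :: "'a::linorder set"
  assumes "finite S"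
  shows "card (ascending_placements S L) = (L + 1 - card S) ^ card S"
  using assms
proof (induction S arbitrary: L rule: finite_linorder_max_induct)
  case empty
  have "ascending_placements ({} :: 'a set) L = {\<lambda>_. undefined}"
    by (auto simp: ascending_placements_def)
  then show ?case by simp
next
  case (insert b S)
  have card_insert: "card (insert b S) = Suc (card S)"
    using insert.hyps by (subst card_insert_disjoint) auto
  show ?case
  proof (cases L)
    case 0
    then have "ascending_placements (insert b S) L = {}"
      by (auto simp: ascending_placements_def PiE_def Pi_def)
    with 0 card_insert show ?thesis by simp
  next
    case (Suc L')
    let ?Y = "ascending_placements S L'"
    have free: "card ({1..Suc L'} - y ` S) = Suc L' - card S" if "y \<in> ?Y" for y
    proof -
      have "inj_on y S"
        using that by (intro linorder_inj_onI) (auto simp: ascending_placements_def)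
      moreover have "y ` S \<subseteq> {1..Suc L'}"
        using that by (fastforce simp: ascending_placements_def PiE_def Pi_def)
      ultimately show ?thesis
        using insert.hyps by (simp add: card_Diff_subset card_image)
    qed
    have "card (ascending_placements (insert b S) (Suc L'))
        = card (SIGMA y : ?Y. {1..Suc L'} - y ` S)"
      using insert.hyps bij_betw_same_card[OF ascending_placements_insert[of S b L']] by simp
    also have "\<dots> = card ?Y * (Suc L' - card S)"
      using free finite_ascending_placements[OF insert.hyps(1)] by (intro card_Sigma_const) auto
    finally show ?thesis
      using Suc insert.IH card_insert by simp
  qed
qed

text \<open>
  The coordinate \<open>c\<close> is the cell of label \<open>1\<close>, and \<open>y i\<close> is the clockwise distance from it to label \<open>i\<close>.
  The equations with \<open>x 1\<close> exclude the distances \<open>0\<close> and \<open>p - 1\<close>. The remaining distances range over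
  \<open>{1..p - 2}\<close>, where \<open>y j + 1\<close> does not wrap around, so that the other congruences modulo \<open>p\<close> become
  equalities of numbers.
\<close>

lemma complement_Shi_bij:
  assumes "n \<ge> 1" "p \<ge> 2"
  shows "bij_betw (\<lambda>(c, y). \<lambda>i\<in>{1..n}. if i = 1 then c else (c + int (y i)) mod int p)
     ({0..<int p} \<times> ascending_placements {2..n} (p - 2))
     (complement_mod n p (Shi n))"
  (is "bij_betw ?f ?A ?C")
proof (rule bij_betwI[where g = "\<lambda>x. (x 1, \<lambda>i\<in>{2..n}. nat ((x i - x 1) mod int p))"])
  show "?f \<in> ?A \<rightarrow> ?C"
  proof (clarify)
    fix c y
    assume c: "c \<in> {0..<int p}" and "y \<in> ascending_placements {2..n} (p - 2)"
    then have y: "\<And>i. i \<in> {2..n} \<Longrightarrow> 1 \<le> y i \<and> y i \<le> p - 2"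
      "\<And>i j. i \<in> {2..n} \<Longrightarrow> j \<in> {2..n} \<Longrightarrow> i < j \<Longrightarrow> y i \<noteq> y j \<and> y i \<noteq> Suc (y j)"
      by (auto simp: ascending_placements_def PiE_def Pi_def)
    let ?x = "\<lambda>i\<in>{1..n}. if i = 1 then c else (c + int (y i)) mod int p"
    \<comment> \<open>Label \<open>1\<close> has distance \<open>0\<close> from itself; this treats all labels alike.\<close>
    define z where "z i = (if i = 1 then 0 else int (y i))" for i
    have x: "[?x i = c + z i] (mod int p)" if "i \<in> {1..n}" for i
      using that by (auto simp: z_def cong_def)
    have shift: "[?x i = ?x j + a] (mod int p) \<longleftrightarrow> [z i = z j + a] (mod int p)"
      if "i \<in> {1..n}" "j \<in> {1..n}" for i j a
    proof -
      have "[?x i = ?x j + a] (mod int p) \<longleftrightarrow> [c + z i = c + (z j + a)] (mod int p)"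
        using x[OF that(1)] cong_add[OF x[OF that(2)] cong_refl[of a]]
        unfolding add.assoc[symmetric] by (meson cong_trans cong_sym)
      then show ?thesis by (simp add: cong_add_lcancel)
    qed
    have small: "z i \<in> {0..<int p}" "z i + 1 \<in> {0..<int p}" if "i \<in> {1..n}" for i
      using that y(1)[of i] assms by (auto simp: z_def)
    have "\<not> [?x i = ?x j] (mod int p) \<and> \<not> [?x i = ?x j + 1] (mod int p)"
      if "1 \<le> i" "i < j" "j \<le> n" for i j
    proof -
      have ij: "i \<in> {1..n}" "j \<in> {1..n}" using that by auto
      have "z i \<noteq> z j \<and> z i \<noteq> z j + 1"
        using that y(1)[of j] y(2)[of i j] by (auto simp: z_def)
      then show ?thesis
        using shift[OF ij, of 0] shift[OF ij, of 1] small[OF ij(1)] small[OF ij(2)]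
        by (simp add: cong_residues_iff del: restrict_apply)
    qed
    moreover have "?x \<in> affine_space_mod n p"
      using c assms by (auto simp: affine_space_mod_def)
    ultimately show "?x \<in> ?C"
      unfolding mem_complement_Shi by blast
  qed
  show "(\<lambda>x. (x 1, \<lambda>i\<in>{2..n}. nat ((x i - x 1) mod int p))) \<in> ?C \<rightarrow> ?A"
  proof
    fix x assume "x \<in> ?C"
    then have x: "x \<in> {1..n} \<rightarrow>\<^sub>E {0..<int p}"
      "\<And>i j. 1 \<le> i \<Longrightarrow> i < j \<Longrightarrow> j \<le> n \<Longrightarrow>
        \<not> [x i = x j] (mod int p) \<and> \<not> [x i = x j + 1] (mod int p)"
      unfolding mem_complement_Shi affine_space_mod_def by blast+
    define d where "d i = (x i - x 1) mod int p" for i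
    have d: "[x i = x 1 + d i] (mod int p)" for i
      by (simp add: d_def cong_def mod_simps)
    have d_pos: "0 \<le> d i" "d i < int p" for i
      using assms by (simp_all add: d_def)
    have shift: "[x i = x j + a] (mod int p)" if "d i = d j + a" for i j a
    proof -
      have "[x i = (x 1 + d j) + a] (mod int p)"
        using d[of i] that by (simp add: add.assoc)
      then show ?thesis
        using cong_add[OF d[of j] cong_refl[of a]] by (meson cong_trans cong_sym)
    qed
    have d_ends: "d j \<noteq> 0 \<and> d j \<noteq> int p - 1" if "j \<in> {2..n}" for j
    proof
      show "d j \<noteq> 0"
        using d[of j] x(2)[of 1 j] that by (auto simp: cong_sym_eq)
      show "d j \<noteq> int p - 1"
      proof
        assume "d j = int p - 1"
        then have "[x j + 1 = x 1 + (int p - 1) + 1] (mod int p)"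
          using cong_add[OF d[of j] cong_refl[of 1]] by simp
        then have "[x 1 = x j + 1] (mod int p)"
          by (simp add: cong_def)
        then show False
          using x(2)[of 1 j] that by auto
      qed
    qed
    let ?y = "\<lambda>i\<in>{2..n}. nat (d i)"
    have "?y i \<noteq> ?y j \<and> ?y i \<noteq> Suc (?y j)" if "i \<in> {2..n}" "j \<in> {2..n}" "i < j" for i j
    proof -
      have "d i \<noteq> d j" "d i \<noteq> d j + 1"
        using shift[of i j 0] shift[of i j 1] x(2)[of i j] that by auto
      then show ?thesis
        using that d_pos(1)[of i] d_pos(1)[of j] by auto
    qed
    moreover have "?y \<in> {2..n} \<rightarrow>\<^sub>E {1..p - 2}"
    proof (rule restrict_PiE_iff[THEN iffD2], rule ballI)
      fix i assume "i \<in> {2..n}"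
      then show "nat (d i) \<in> {1..p - 2}"
        using d_ends[of i] d_pos[of i] by auto
    qed
    moreover have "x 1 \<in> {0..<int p}"
      using x(1) assms by auto
    ultimately have "(x 1, ?y) \<in> ?A"
      unfolding ascending_placements_def by blast
    then show "(x 1, \<lambda>i\<in>{2..n}. nat ((x i - x 1) mod int p)) \<in> ?A"
      unfolding d_def .
  qed
  show "(?f a 1, \<lambda>i\<in>{2..n}. nat ((?f a i - ?f a 1) mod int p)) = a" if "a \<in> ?A" for a
  proof -
    obtain c y where a: "a = (c, y)" by (cases a)
    have y: "y \<in> extensional {2..n}" "\<And>i. i \<in> {2..n} \<Longrightarrow> y i \<le> p - 2"
      using that a by (auto simp: ascending_placements_def PiE_def Pi_def)
    have "nat (int (y i) mod int p) = y i" if "i \<in> {2..n}" for i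
      using y(2)[OF that] assms by (simp flip: zmod_int)
    then show ?thesis
      using y(1) assms unfolding a by (auto simp: fun_eq_iff extensional_def mod_simps)
  qed
  show "?f (x 1, \<lambda>i\<in>{2..n}. nat ((x i - x 1) mod int p)) = x" if "x \<in> ?C" for x
  proof
    fix i
    have x: "x \<in> {1..n} \<rightarrow>\<^sub>E {0..<int p}"
      using that unfolding mem_complement_Shi affine_space_mod_def by blast
    show "?f (x 1, \<lambda>i\<in>{2..n}. nat ((x i - x 1) mod int p)) i = x i"
    proof (cases "i \<in> {1..n}")
      case True
      then have "x i \<in> {0..<int p}" using x by blast
      then show ?thesis using True assms by (auto simp: mod_simps)
    next
      case False
      then show ?thesis using x by (auto simp: PiE_def extensional_def)
    qed
  qed
qed

lemma card_complement_Shi: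
  assumes "n \<ge> 1" "p \<ge> 2"
  shows "card (complement_mod n p (Shi n)) = p * (p - n) ^ (n - 1)"
proof -
  have "card (complement_mod n p (Shi n))
      = card ({0..<int p} \<times> ascending_placements {2..n} (p - 2))"
    using bij_betw_same_card[OF complement_Shi_bij[OF assms]] by simp
  also have "\<dots> = p * (p - 2 + 1 - (n - 1)) ^ (n - 1)"
    using assms by (simp add: card_cartesian_product card_ascending_placements)
  also have "p - 2 + 1 - (n - 1) = p - n"
    using assms by simp
  finally show ?thesis .
qed

section \<open>The common characteristic polynomial\<close>

lemma characteristic_polynomial_from_counts:
  assumes "n \<ge> 1"
    and "\<And>p. p \<ge> max 2 n \<Longrightarrow> card (complement_mod n p A) = p * (p - n) ^ (n - 1)"
  shows "characteristic_polynomial n A = [:0, 1:] * [:- int n, 1:] ^ (n - 1)"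
proof (rule characteristic_polynomial_eqI)
  have "poly ([:0, 1:] * [:- int n, 1:] ^ (n - 1)) (int p) = int (card (complement_mod n p A))"
    if "p \<ge> max 2 n" for p
    using assms(2)[OF that] that by (simp add: of_nat_diff)
  then show "is_characteristic_polynomial n A ([:0, 1:] * [:- int n, 1:] ^ (n - 1))"
    unfolding is_characteristic_polynomial_def complement_mod_def eventually_sequentially
    by blast
qed

theorem theorem1:
  fixes n :: nat
  assumes "n \<ge> 1"
  shows "characteristic_polynomial n (Shi n) = characteristic_polynomial n (Ish n) \<and>
         characteristic_polynomial n (Ish n) = [:0, 1:] * [:- int n, 1:] ^ (n - 1)"
proof -
  have "characteristic_polynomial n (Shi n) = [:0, 1:] * [:- int n, 1:] ^ (n - 1)"
    using assms by (intro characteristic_polynomial_from_counts card_complement_Shi) auto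
  moreover have "characteristic_polynomial n (Ish n) = [:0, 1:] * [:- int n, 1:] ^ (n - 1)"
    using assms by (intro characteristic_polynomial_from_counts card_complement_Ish) auto
  ultimately show ?thesis by simp
qed

end
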